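(* Let $m,n$ be nonnegative integers with $m\ge 1$, let $\mathfrak{s}$ be an $m$-star and $\mathfrak{c}$ an $n$-chain (on disjoint ground sets), and let $\mathfrak{S\!C}_{m,n}^{\bullet}$ denote the set of proper mergings of $\mathfrak{s}$ and $\mathfrak{c}$. Then \[ \bigl\lvert\mathfrak{S\!C}_{m,n}^{\bullet}\bigr\rvert=\sum_{k=1}^{n+1} k^{m}(n-k+2)^{m+1}. \]
   Context: Let $(P,\le_P)$ and $(Q,\le_Q)$ be posets on disjoint ground sets. For relations $R\subseteq P\times Q$ and $T\subseteq Q\times P$, define the relation $\le_{R,T}$ on $P\cup Q$ by: $x\le_{R,T} y$ iff $x\le_P y$, or $x\le_Q y$, or $(x,y)\in R$, or $(x,y)\in T$. The pair $(R,T)$ is a merging of $P$ and $Q$ if $\le_{R,T}$ is a quasi-order (reflexive and transitive) on $P\cup Q$; it is a proper merging if in addition $R\cap T^{-1}=\emptyset$ (equivalently, $\le_{R,T}$ is a partial order). An $m$-star is the poset on $S=\{s_0,s_1,\dots,s_m\}$ with $s\le s'$ iff $s=s'$ or $s=s_0$ (an $m$-element antichain with a least element adjoined). An $n$-chain is the poset on $C=\{c_1,\dots,c_n\}$ with $c_i\le c_j$ iff $i\le j$ (for $n=0$ it is empty). *)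

theory Defs
  imports Main
begin

text \<open>A poset is a carrier set together with its order, a set of pairs.\<close>

definition merged_rel :: "'a rel \<Rightarrow> 'a rel \<Rightarrow> 'a rel \<Rightarrow> 'a rel \<Rightarrow> 'a rel" where
  "merged_rel leP leQ R T = leP \<union> leQ \<union> R \<union> T"

definition merging ::
    "'a set \<Rightarrow> 'a rel \<Rightarrow> 'a set \<Rightarrow> 'a rel \<Rightarrow> 'a rel \<Rightarrow> 'a rel \<Rightarrow> bool" where
  "merging P leP Q leQ R T \<longleftrightarrow>
     R \<subseteq> P \<times> Q \<and> T \<subseteq> Q \<times> P \<and> preorder_on (P \<union> Q) (merged_rel leP leQ R T)"

definition proper_merging ::
    "'a set \<Rightarrow> 'a rel \<Rightarrow> 'a set \<Rightarrow> 'a rel \<Rightarrow> 'a rel \<Rightarrow> 'a rel \<Rightarrow> bool" where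
  "proper_merging P leP Q leQ R T \<longleftrightarrow> merging P leP Q leQ R T \<and> R \<inter> T\<inverse> = {}"

definition proper_mergings ::
    "'a set \<Rightarrow> 'a rel \<Rightarrow> 'a set \<Rightarrow> 'a rel \<Rightarrow> ('a rel \<times> 'a rel) set" where
  "proper_mergings P leP Q leQ = {(R, T). proper_merging P leP Q leQ R T}"

lemma proper_merging_iff_partial_order_on:
  assumes "partial_order_on P leP" "partial_order_on Q leQ" "P \<inter> Q = {}"
  shows "proper_merging P leP Q leQ R T \<longleftrightarrow>
    R \<subseteq> P \<times> Q \<and> T \<subseteq> Q \<times> P \<and> partial_order_on (P \<union> Q) (merged_rel leP leQ R T)"
proof -
  have sub: "leP \<subseteq> P \<times> P" "leQ \<subseteq> Q \<times> Q" and anti: "antisym leP" "antisym leQ"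
    using assms by (auto simp: partial_order_on_def preorder_on_def)
  have "R \<inter> T\<inverse> = {} \<longleftrightarrow> antisym (merged_rel leP leQ R T)" if RT: "R \<subseteq> P \<times> Q" "T \<subseteq> Q \<times> P"
  proof
    assume *: "R \<inter> T\<inverse> = {}"
    show "antisym (merged_rel leP leQ R T)"
    proof (rule antisymI)
      fix x y
      assume "(x, y) \<in> merged_rel leP leQ R T" "(y, x) \<in> merged_rel leP leQ R T"
      moreover have "(x, y) \<in> leP \<Longrightarrow> (y, x) \<in> leP \<Longrightarrow> x = y"
        "(x, y) \<in> leQ \<Longrightarrow> (y, x) \<in> leQ \<Longrightarrow> x = y"
        using anti by (auto dest: antisymD)
      ultimately show "x = y"
        using sub RT assms(3) * unfolding merged_rel_def by blast
    qed
  next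
    assume *: "antisym (merged_rel leP leQ R T)"
    have "x = y" if "(x, y) \<in> R" "(y, x) \<in> T" for x y
      using antisymD[OF *] that by (auto simp: merged_rel_def)
    then show "R \<inter> T\<inverse> = {}"
      using RT assms(3) by blast
  qed
  then show ?thesis
    by (auto simp: proper_merging_def merging_def partial_order_on_def)
qed

text \<open>
  The points \<open>s\<^sub>0, \<dots>, s\<^sub>m\<close> of a star and \<open>c\<^sub>1, \<dots>, c\<^sub>n\<close> of a chain are given by functions
  on \<^typ>\<open>nat\<close>, assumed injective on the relevant indices wherever the definitions are used.
\<close>

definition star_set :: "nat \<Rightarrow> (nat \<Rightarrow> 'a) \<Rightarrow> 'a set" where
  "star_set m s = s ` {0..m}"

definition star_le :: "nat \<Rightarrow> (nat \<Rightarrow> 'a) \<Rightarrow> 'a rel" where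
  "star_le m s = {(x, y). x \<in> star_set m s \<and> y \<in> star_set m s \<and> (x = y \<or> x = s 0)}"

definition chain_set :: "nat \<Rightarrow> (nat \<Rightarrow> 'a) \<Rightarrow> 'a set" where
  "chain_set n c = c ` {1..n}"

definition chain_le :: "nat \<Rightarrow> (nat \<Rightarrow> 'a) \<Rightarrow> 'a rel" where
  "chain_le n c = {(c i, c j) | i j. i \<in> {1..n} \<and> j \<in> {1..n} \<and> i \<le> j}"

lemma partial_order_on_star: "partial_order_on (star_set m s) (star_le m s)"
  by (auto simp: partial_order_on_def preorder_on_def refl_on_def star_le_def
      intro!: transI antisymI)

lemma partial_order_on_chain:
  assumes "inj_on c {1..n}"
  shows "partial_order_on (chain_set n c) (chain_le n c)"
proof -
  have eq: "c i = c j \<longleftrightarrow> i = j" if "i \<in> {1..n}" "j \<in> {1..n}" for i j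
    using assms that by (auto dest: inj_onD)
  have "trans (chain_le n c)"
  proof (rule transI)
    fix x y z
    assume "(x, y) \<in> chain_le n c" "(y, z) \<in> chain_le n c"
    then obtain i j j' k where "x = c i" "y = c j" "y = c j'" "z = c k" "i \<le> j" "j' \<le> k"
      "i \<in> {1..n}" "j \<in> {1..n}" "j' \<in> {1..n}" "k \<in> {1..n}"
      unfolding chain_le_def by blast
    moreover from this have "i \<le> k" using eq[of j j'] by simp
    ultimately show "(x, z) \<in> chain_le n c" unfolding chain_le_def by blast
  qed
  moreover have "antisym (chain_le n c)"
  proof (rule antisymI)
    fix x y
    assume "(x, y) \<in> chain_le n c" "(y, x) \<in> chain_le n c"
    then obtain i j i' j' where "x = c i" "y = c j" "y = c j'" "x = c i'" "i \<le> j" "j' \<le> i'"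
      "i \<in> {1..n}" "j \<in> {1..n}" "j' \<in> {1..n}" "i' \<in> {1..n}"
      unfolding chain_le_def by blast
    then show "x = y" using eq[of j j'] eq[of i i'] by simp
  qed
  moreover have "chain_le n c \<subseteq> chain_set n c \<times> chain_set n c"
    by (auto simp: chain_set_def chain_le_def)
  moreover have "refl_on (chain_set n c) (chain_le n c)"
    unfolding refl_on_def chain_set_def chain_le_def by blast
  ultimately show ?thesis
    by (simp add: partial_order_on_def preorder_on_def)
qed

end

(*
A proper merging is determined by two thresholds for each star element s_i: c_j lies below s_i iff
j <= alpha_i, and s_i lies below c_j iff beta_i < j, with 0 <= alpha_i, beta_i <= n. Transitivity
and properness amount to alpha_0 <= beta_0, alpha_0 <= alpha_i, beta_0 <= beta_i and
alpha_k <= beta_i for all i, k >= 1. Given p = alpha_0, q = beta_0 and M = max {alpha_i | i >= 1},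
there are (M - p + 1)^m - (M - p)^m choices of the other alphas and (n + 1 - max q M)^m of the other
betas. Summation by parts over p and q leaves the sum of (M + 1)^(m + 1) (n + 1 - M)^m over M <= n,
which is the claimed sum read backwards with k = n + 1 - M.
*)
theory Submission
  imports Defs "HOL-Library.FuncSet"
begin

section \<open>Counting functions by their maximum\<close>

text \<open>Maximum \<open>M\<close> means that all values are at most \<open>M\<close> but not all
  are below it, so the count is a difference of two full function spaces.\<close>

lemma card_PiE_Max_eq:
  fixes p M n :: nat
  assumes "finite I" "I \<noteq> {}" "p \<le> M" "M \<le> n"
  shows "card {a \<in> I \<rightarrow>\<^sub>E {p..n}. Max (a ` I) = M} = (M - p + 1) ^ card I - (M - p) ^ card I"
proof -
  have eq: "{a \<in> I \<rightarrow>\<^sub>E {p..n}. Max (a ` I) = M} = (I \<rightarrow>\<^sub>E {p..M}) - (I \<rightarrow>\<^sub>E {p..<M})"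
  proof (intro equalityI subsetI)
    fix a assume "a \<in> {a \<in> I \<rightarrow>\<^sub>E {p..n}. Max (a ` I) = M}"
    then have a: "a \<in> I \<rightarrow>\<^sub>E {p..n}" and M: "Max (a ` I) = M" by auto
    have "a i \<le> M" if "i \<in> I" for i
      using that assms(1) M by (metis Max_ge finite_imageI imageI)
    moreover have "M \<in> a ` I"
      using assms M by (metis Max_in finite_imageI image_is_empty)
    ultimately show "a \<in> (I \<rightarrow>\<^sub>E {p..M}) - (I \<rightarrow>\<^sub>E {p..<M})"
      using a by (fastforce simp: PiE_iff)
  next
    fix a assume "a \<in> (I \<rightarrow>\<^sub>E {p..M}) - (I \<rightarrow>\<^sub>E {p..<M})"
    then have a: "a \<in> I \<rightarrow>\<^sub>E {p..M}" and "\<exists>i\<in>I. \<not> a i < M" by (auto simp: PiE_iff)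
    then obtain i where "i \<in> I" "a i = M" by (force simp: PiE_iff)
    then have "Max (a ` I) = M"
      using a assms(1) by (intro Max_eqI) (auto simp: PiE_iff)
    then show "a \<in> {a \<in> I \<rightarrow>\<^sub>E {p..n}. Max (a ` I) = M}"
      using a assms(4) by (force simp: PiE_iff)
  qed
  have "(I \<rightarrow>\<^sub>E {p..<M}) \<subseteq> (I \<rightarrow>\<^sub>E {p..M})" by (intro PiE_mono) auto
  then show ?thesis
    unfolding eq using assms
    by (subst card_Diff_subset) (auto simp: card_PiE finite_PiE Suc_diff_le)
qed

text \<open>Grouping by the maximum; this is how the \<open>Max\<close> in \<open>thresholds\<close>
  is eliminated from the count.\<close>

lemma sum_PiE_Max:
  fixes p n :: nat and g :: "nat \<Rightarrow> nat"
  assumes "finite I" "I \<noteq> {}"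
  shows "(\<Sum>a \<in> I \<rightarrow>\<^sub>E {p..n}. g (Max (a ` I))) =
    (\<Sum>M = p..n. ((M - p + 1) ^ card I - (M - p) ^ card I) * g M)"
proof -
  have "(\<lambda>a. Max (a ` I)) ` (I \<rightarrow>\<^sub>E {p..n}) \<subseteq> {p..n}"
  proof (rule image_subsetI)
    fix a assume a: "a \<in> I \<rightarrow>\<^sub>E {p..n}"
    have "Max (a ` I) \<in> a ` I" using assms by (intro Max_in) auto
    with a show "Max (a ` I) \<in> {p..n}" by (auto simp: PiE_iff)
  qed
  then have "(\<Sum>a \<in> I \<rightarrow>\<^sub>E {p..n}. g (Max (a ` I))) =
      (\<Sum>M = p..n. \<Sum>a \<in> {a \<in> I \<rightarrow>\<^sub>E {p..n}. Max (a ` I) = M}. g (Max (a ` I)))"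
    using assms by (intro sum.group[symmetric]) (auto intro: finite_PiE)
  also have "\<dots> = (\<Sum>M = p..n. card {a \<in> I \<rightarrow>\<^sub>E {p..n}. Max (a ` I) = M} * g M)"
    by (intro sum.cong refl) simp
  also have "\<dots> = (\<Sum>M = p..n. ((M - p + 1) ^ card I - (M - p) ^ card I) * g M)"
    using assms by (intro sum.cong refl) (simp add: card_PiE_Max_eq)
  finally show ?thesis .
qed

section \<open>Summation by parts\<close>

text \<open>Abel summation, with the subtracted sum moved to the left so that it stays within
  \<open>nat\<close>; \<open>mono u\<close> makes the remaining differences genuine.\<close>

lemma sum_diff_mult_index:
  fixes u :: "nat \<Rightarrow> nat"
  assumes "mono u" "u 0 = 0"
  shows "(\<Sum>d\<le>M. (u (d + 1) - u d) * d) + (\<Sum>d\<le>M. u d) = M * u (M + 1)"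
proof (induction M)
  case (Suc M)
  have "u (Suc M) \<le> u (Suc (Suc M))" using assms by (simp add: monoD)
  then have "(u (Suc (Suc M)) - u (Suc M)) * Suc M + u (Suc M) * Suc M = u (Suc (Suc M)) * Suc M"
    by (metis add_mult_distrib le_add_diff_inverse2)
  then show ?case using Suc by (simp add: algebra_simps)
qed (simp add: assms)

text \<open>Each of the \<open>M - p\<close> indices \<open>q\<close> below \<open>M\<close>
  contributes the constant \<open>g M\<close>.\<close>

lemma sum_max_split:
  fixes g :: "nat \<Rightarrow> nat"
  assumes "p \<le> M" "M \<le> n"
  shows "(\<Sum>q = p..n. g (max q M)) = (M - p) * g M + (\<Sum>q = M..n. g q)"
proof -
  have "{p..n} = {p..<M} \<union> {M..n}" using assms by auto
  then have "(\<Sum>q = p..n. g (max q M)) = (\<Sum>q = p..<M. g (max q M)) + (\<Sum>q = M..n. g (max q M))"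
    by (simp add: sum.union_disjoint ivl_disj_int)
  then show ?thesis by (simp add: max_absorb1 max_absorb2)
qed

text \<open>After the exchanges, \<open>g M\<close> collects \<open>D M\<close> from the indices
  \<open>q\<close> below the maximum, and \<open>u 1 + ... + u (M + 1)\<close> from its occurrences
  in the tails starting at a maximum. Abel summation adds the two up.\<close>

lemma sum_threshold:
  fixes u g :: "nat \<Rightarrow> nat"
  assumes "mono u" "u 0 = 0"
  shows "(\<Sum>p\<le>n. \<Sum>q = p..n. \<Sum>M = p..n. (u (M - p + 1) - u (M - p)) * g (max q M)) =
    (\<Sum>M\<le>n. (M + 1) * u (M + 1) * g M)" (is "?L = ?R")
proof -
  \<comment> \<open>Exchange over the triangle \<open>p <= M <= n\<close>; it serves first for the
    pair \<open>p\<close>, \<open>M\<close> and later for the pair \<open>M\<close>,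
    \<open>q\<close>.\<close>
  have swap: "(\<Sum>p\<le>n. \<Sum>M = p..n. f p M) = (\<Sum>M\<le>n. \<Sum>p\<le>M. f p M)"
    for f :: "nat \<Rightarrow> nat \<Rightarrow> nat"
    unfolding sum.Sigma[OF finite_atMost ballI[OF finite_atLeastAtMost]]
      sum.Sigma[OF finite_atMost ballI[OF finite_atMost]]
    by (rule sum.reindex_bij_witness[of _ prod.swap prod.swap]) auto
  have tele: "(\<Sum>d\<le>M. u (d + 1) - u d) = u (M + 1)" for M
    using assms(2) by (induction M) (auto simp: monoD[OF assms(1)])
  define D where "D M = (\<Sum>d\<le>M. (u (d + 1) - u d) * d)" for M
  have D: "D M + (\<Sum>d\<le>M. u d) = M * u (M + 1)" for M
    using sum_diff_mult_index[OF assms] by (simp add: D_def)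
  have "?L = (\<Sum>p\<le>n. \<Sum>M = p..n. \<Sum>q = p..n. (u (M - p + 1) - u (M - p)) * g (max q M))"
    by (intro sum.cong refl sum.swap)
  also have "\<dots> = (\<Sum>M\<le>n. \<Sum>p\<le>M. \<Sum>q = p..n. (u (M - p + 1) - u (M - p)) * g (max q M))"
    by (rule swap)
  also have "\<dots> = (\<Sum>M\<le>n. \<Sum>p\<le>M. (u (M - p + 1) - u (M - p)) *
      ((M - p) * g M + (\<Sum>q = M..n. g q)))"
    by (intro sum.cong refl) (simp add: sum_max_split flip: sum_distrib_left)
  \<comment> \<open>Substitutes \<open>d = M - p\<close>, after which the tail no longer depends on
    the inner index and the differences telescope.\<close>
  also have "\<dots> = (\<Sum>M\<le>n. \<Sum>d\<le>M. (u (d + 1) - u d) * (d * g M + (\<Sum>q = M..n. g q)))"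
    by (intro sum.cong refl sum.reindex_bij_witness[of _ "\<lambda>d. M - d" "\<lambda>d. M - d" for M]) auto
  also have "\<dots> = (\<Sum>M\<le>n. D M * g M) + (\<Sum>M\<le>n. \<Sum>q = M..n. u (M + 1) * g q)"
    unfolding D_def
    by (simp only: distrib_left sum.distrib tele mult.assoc[symmetric] sum_distrib_right[symmetric]
        sum_distrib_left[symmetric])
  also have "(\<Sum>M\<le>n. \<Sum>q = M..n. u (M + 1) * g q) = (\<Sum>q\<le>n. (\<Sum>d\<le>q. u (d + 1)) * g q)"
    unfolding swap sum_distrib_right ..
  also have "(\<Sum>M\<le>n. D M * g M) + \<dots> = (\<Sum>M\<le>n. (D M + (\<Sum>d\<le>M. u (d + 1))) * g M)"
    by (simp add: sum.distrib distrib_right)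
  also have "\<dots> = ?R"
  proof (intro sum.cong refl arg_cong2[where f = "(*)"])
    fix M
    \<comment> \<open>The index shift costs only \<open>u 0 = 0\<close>.\<close>
    have "(\<Sum>d\<le>M. u (d + 1)) = (\<Sum>d\<le>M. u d) + u (M + 1)"
      using sum.atMost_Suc_shift[of u M] sum.atMost_Suc[of u M] assms(2) by simp
    then show "D M + (\<Sum>d\<le>M. u (d + 1)) = (M + 1) * u (M + 1)" using D[of M] by simp
  qed
  finally show ?thesis .
qed

section \<open>Counting threshold tuples\<close>

text \<open>
  A tuple \<open>(p, q, a, b)\<close> has \<open>p\<close>, \<open>q\<close> as the thresholds of \<open>s\<^sub>0\<close> and \<open>a i\<close>, \<open>b i\<close> as those of \<open>s\<^sub>i\<close>
  for \<open>i \<ge> 1\<close>: below \<open>s\<^sub>i\<close> lie the \<open>c\<^sub>j\<close> with \<open>j \<le> a i\<close>, above it those with \<open>b i < j\<close>.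
\<close>

definition thresholds :: "nat \<Rightarrow> nat \<Rightarrow> (nat \<times> nat \<times> (nat \<Rightarrow> nat) \<times> (nat \<Rightarrow> nat)) set" where
  "thresholds m n = (SIGMA p:{..n}. SIGMA q:{p..n}. SIGMA a:{1..m} \<rightarrow>\<^sub>E {p..n}.
     {1..m} \<rightarrow>\<^sub>E {max q (Max (a ` {1..m}))..n})"

lemma card_thresholds:
  assumes "m \<ge> 1"
  shows "card (thresholds m n) = (\<Sum>k = 1..n + 1. k ^ m * (n + 2 - k) ^ (m + 1))"
proof -
  have "card (thresholds m n) = (\<Sum>p\<le>n. \<Sum>q = p..n. \<Sum>a \<in> {1..m} \<rightarrow>\<^sub>E {p..n}.
      (n + 1 - max q (Max (a ` {1..m}))) ^ m)"
    unfolding thresholds_def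
    by (simp add: card_SigmaI finite_PiE finite_SigmaI card_PiE)
  also have "\<dots> = (\<Sum>p\<le>n. \<Sum>q = p..n. \<Sum>M = p..n.
      ((M - p + 1) ^ m - (M - p) ^ m) * (n + 1 - max q M) ^ m)"
    using assms sum_PiE_Max[of "{1..m}", where g = "\<lambda>M. (n + 1 - max q M) ^ m" for q]
    by (intro sum.cong refl) simp
  \<comment> \<open>\<open>sum_threshold\<close> with \<open>u d = d ^ m\<close>; here
    \<open>m >= 1\<close> gives \<open>u 0 = 0\<close>.\<close>
  also have "\<dots> = (\<Sum>M\<le>n. (M + 1) * (M + 1) ^ m * (n + 1 - M) ^ m)"
    using assms by (intro sum_threshold[of "\<lambda>d. d ^ m" "\<lambda>M. (n + 1 - M) ^ m"])
      (auto intro!: monoI power_mono)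
  \<comment> \<open>Reversal by \<open>k = n + 1 - M\<close>, so that \<open>M + 1\<close> becomes
    \<open>n + 2 - k\<close>.\<close>
  also have "\<dots> = (\<Sum>k = 1..n + 1. k ^ m * (n + 2 - k) ^ (m + 1))"
    by (rule sum.reindex_bij_witness[of _ "\<lambda>k. n + 1 - k" "\<lambda>M. n + 1 - M"])
      (auto simp: Suc_diff_le mult_ac)
  finally show ?thesis .
qed

text \<open>The definition uses \<open>Max\<close> so that it is an iterated \<open>SIGMA\<close>
  that can be counted; the pairwise form is what transitivity and properness produce.
  \<open>m >= 1\<close> keeps \<open>Max\<close> off the empty set.\<close>

lemma mem_thresholds_iff:
  assumes "m \<ge> 1"
  shows "(p, q, a, b) \<in> thresholds m n \<longleftrightarrow> p \<le> q \<and> q \<le> n \<and>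
    a \<in> {1..m} \<rightarrow>\<^sub>E {p..n} \<and> b \<in> {1..m} \<rightarrow>\<^sub>E {q..n} \<and> (\<forall>i\<in>{1..m}. \<forall>k\<in>{1..m}. a k \<le> b i)"
proof -
  have "Max (a ` {1..m}) \<le> x \<longleftrightarrow> (\<forall>k\<in>{1..m}. a k \<le> x)" for x
    using assms by (subst Max_le_iff) auto
  then show ?thesis unfolding thresholds_def by (auto simp: PiE_iff)
qed

text \<open>A down-closed subset of \<open>{1..n}\<close> is an initial segment, so its size is its
  threshold: a member \<open>j\<close> puts \<open>{1..j}\<close> inside, a non-member
  \<open>j\<close> confines the set to \<open>{1..<j}\<close>.\<close>

lemma down_closed_iff_le_card:
  assumes "\<And>j k. j \<in> {1..n} \<Longrightarrow> k \<in> {1..n} \<Longrightarrow> k \<le> j \<Longrightarrow> Q j \<Longrightarrow> Q k" "j \<in> {1..n}"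
  shows "Q j \<longleftrightarrow> j \<le> card {j \<in> {1..n}. Q j}"
proof
  assume "Q j"
  then have "{1..j} \<subseteq> {j \<in> {1..n}. Q j}" using assms by fastforce
  from card_mono[OF _ this] show "j \<le> card {j \<in> {1..n}. Q j}" by simp
next
  assume le: "j \<le> card {j \<in> {1..n}. Q j}"
  show "Q j"
  proof (rule ccontr)
    assume "\<not> Q j"
    then have "k < j" if "k \<in> {1..n}" "Q k" for k
      using assms(1)[of k j] assms(2) that by (meson linorder_not_less)
    then have "{j \<in> {1..n}. Q j} \<subseteq> {1..<j}" by fastforce
    from card_mono[OF _ this] le assms(2) show False by auto
  qed
qed

section \<open>Transitivity and properness in coordinates\<close>

locale star_chain =
  fixes m n :: nat and s c :: "nat \<Rightarrow> 'a"
  assumes inj_s: "inj_on s {0..m}" and inj_c: "inj_on c {1..n}"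
    and disj: "star_set m s \<inter> chain_set n c = {}"
begin

lemma s_eq_iff: "i \<le> m \<Longrightarrow> j \<le> m \<Longrightarrow> s i = s j \<longleftrightarrow> i = j"
  using inj_s by (auto dest: inj_onD)

lemma c_eq_iff: "i \<in> {1..n} \<Longrightarrow> j \<in> {1..n} \<Longrightarrow> c i = c j \<longleftrightarrow> i = j"
  using inj_c by (auto dest: inj_onD)

lemma s_neq_c: "i \<le> m \<Longrightarrow> j \<in> {1..n} \<Longrightarrow> s i \<noteq> c j"
  using disj by (fastforce simp: star_set_def chain_set_def)

text \<open>Strict here and non-strict in \<open>down_rel\<close>: both thresholds then range over
  \<open>{0..n}\<close>, and properness at \<open>s i\<close> reads
  \<open>\<alpha> i \<le> \<beta> i\<close>.\<close>

definition up_rel :: "(nat \<Rightarrow> nat) \<Rightarrow> 'a rel" where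
  "up_rel \<beta> = {(s i, c j) | i j. i \<le> m \<and> j \<in> {1..n} \<and> \<beta> i < j}"

definition down_rel :: "(nat \<Rightarrow> nat) \<Rightarrow> 'a rel" where
  "down_rel \<alpha> = {(c j, s i) | i j. i \<le> m \<and> j \<in> {1..n} \<and> j \<le> \<alpha> i}"

lemma mem_up_rel: "i \<le> m \<Longrightarrow> j \<in> {1..n} \<Longrightarrow> (s i, c j) \<in> up_rel \<beta> \<longleftrightarrow> \<beta> i < j"
  unfolding up_rel_def using s_eq_iff c_eq_iff by blast

lemma mem_down_rel: "i \<le> m \<Longrightarrow> j \<in> {1..n} \<Longrightarrow> (c j, s i) \<in> down_rel \<alpha> \<longleftrightarrow> j \<le> \<alpha> i"
  unfolding down_rel_def using s_eq_iff c_eq_iff by blast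

text \<open>The conditions are the mixed compositions. A path \<open>s i\<close>,
  \<open>c j\<close>, \<open>s k\<close> forces \<open>i = k\<close> or \<open>i = 0\<close>, and
  properness rules out \<open>i = k\<close>.\<close>

lemma proper_merging_iff:
  assumes R: "R \<subseteq> star_set m s \<times> chain_set n c" and T: "T \<subseteq> chain_set n c \<times> star_set m s"
  shows "proper_merging (star_set m s) (star_le m s) (chain_set n c) (chain_le n c) R T \<longleftrightarrow>
    (\<forall>i\<le>m. \<forall>j\<in>{1..n}. (s i, c j) \<in> R \<longrightarrow>
      (s 0, c j) \<in> R \<and> (\<forall>k\<in>{1..n}. j \<le> k \<longrightarrow> (s i, c k) \<in> R)) \<and>
    (\<forall>i\<le>m. \<forall>j\<in>{1..n}. (c j, s i) \<in> T \<longrightarrow> (\<forall>k\<in>{1..n}. k \<le> j \<longrightarrow> (c k, s i) \<in> T)) \<and>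
    (\<forall>i\<le>m. \<forall>j\<in>{1..n}. (c j, s 0) \<in> T \<longrightarrow> (c j, s i) \<in> T) \<and>
    (\<forall>i\<le>m. \<forall>k\<le>m. \<forall>j\<in>{1..n}. (s i, c j) \<in> R \<and> (c j, s k) \<in> T \<longrightarrow> i = 0 \<and> k \<noteq> 0) \<and>
    (\<forall>i\<le>m. \<forall>j\<in>{1..n}. \<forall>k\<in>{1..n}. (c j, s i) \<in> T \<and> (s i, c k) \<in> R \<longrightarrow> j \<le> k)"
  (is "_ \<longleftrightarrow> ?C")
proof -
  let ?r = "merged_rel (star_le m s) (chain_le n c) R T"
  have carrier: "star_set m s \<union> chain_set n c = s ` {..m} \<union> c ` {1..n}"
    by (simp add: star_set_def chain_set_def atLeast0AtMost)
  have sub: "?r \<subseteq> (star_set m s \<union> chain_set n c) \<times> (star_set m s \<union> chain_set n c)"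
    using R T by (auto simp: merged_rel_def star_le_def chain_le_def chain_set_def)
  have refl: "refl_on (star_set m s \<union> chain_set n c) ?r"
    by (fastforce simp: refl_on_def merged_rel_def star_le_def chain_le_def chain_set_def)
  have s_mem: "s i \<in> star_set m s" "s i \<notin> chain_set n c" if "i \<le> m" for i
    using that s_neq_c by (auto simp: star_set_def chain_set_def)
  have c_mem: "c j \<in> chain_set n c" "c j \<notin> star_set m s" if "j \<in> {1..n}" for j
    using that s_neq_c by (fastforce simp: star_set_def chain_set_def)+
  have chain_sub: "chain_le n c \<subseteq> chain_set n c \<times> chain_set n c"
    by (auto simp: chain_set_def chain_le_def)
  \<comment> \<open>Disjointness splits the merged relation into four blocks: the two given orders,
    \<open>R\<close> and \<open>T\<close>.\<close>
  have ss: "(s i, s j) \<in> ?r \<longleftrightarrow> i = j \<or> i = 0" if "i \<le> m" "j \<le> m" for i j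
    using s_mem[OF that(1)] s_mem[OF that(2)] R T chain_sub that
    by (auto simp: merged_rel_def star_le_def s_eq_iff)
  have cc: "(c i, c j) \<in> ?r \<longleftrightarrow> i \<le> j" if "i \<in> {1..n}" "j \<in> {1..n}" for i j
  proof -
    have "(c i, c j) \<in> chain_le n c \<longleftrightarrow> i \<le> j"
      unfolding chain_le_def using that c_eq_iff by blast
    then show ?thesis
      using c_mem[OF that(1)] c_mem[OF that(2)] R T by (auto simp: merged_rel_def star_le_def)
  qed
  have sc: "(s i, c j) \<in> ?r \<longleftrightarrow> (s i, c j) \<in> R"
    and cs: "(c j, s i) \<in> ?r \<longleftrightarrow> (c j, s i) \<in> T" if "i \<le> m" "j \<in> {1..n}" for i j
    using s_mem[OF that(1)] c_mem[OF that(2)] chain_sub R T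
    by (auto simp: merged_rel_def star_le_def)
  have inter: "R \<inter> T\<inverse> = {} \<longleftrightarrow>
      (\<forall>i\<le>m. \<forall>j\<in>{1..n}. \<not> ((s i, c j) \<in> R \<and> (c j, s i) \<in> T))"
    using R by (fastforce simp: star_set_def chain_set_def)
  have "proper_merging (star_set m s) (star_le m s) (chain_set n c) (chain_le n c) R T \<longleftrightarrow>
      trans ?r \<and> R \<inter> T\<inverse> = {}"
    using R T sub refl by (auto simp: proper_merging_def merging_def preorder_on_def)
  also have "\<dots> \<longleftrightarrow> ?C"
  proof
    assume "trans ?r \<and> R \<inter> T\<inverse> = {}"
    then have tr: "trans ?r"
      and int: "\<And>i j. i \<le> m \<Longrightarrow> j \<in> {1..n} \<Longrightarrow> (s i, c j) \<in> R \<Longrightarrow> (c j, s i) \<notin> T"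
      unfolding inter by blast+
    have C1: "(s 0, c j) \<in> R" if "i \<le> m" "j \<in> {1..n}" "(s i, c j) \<in> R" for i j
      using transD[OF tr, of "s 0" "s i" "c j"] ss[of 0 i] sc[of 0 j] sc[of i j] that by blast
    have C2: "(s i, c k) \<in> R"
      if "i \<le> m" "j \<in> {1..n}" "k \<in> {1..n}" "j \<le> k" "(s i, c j) \<in> R" for i j k
      using transD[OF tr, of "s i" "c j" "c k"] cc[of j k] sc[of i j] sc[of i k] that by blast
    have C3: "(c k, s i) \<in> T"
      if "i \<le> m" "j \<in> {1..n}" "k \<in> {1..n}" "k \<le> j" "(c j, s i) \<in> T" for i j k
      using transD[OF tr, of "c k" "c j" "s i"] cc[of k j] cs[of i j] cs[of i k] that by blast
    have C4: "(c j, s i) \<in> T" if "i \<le> m" "j \<in> {1..n}" "(c j, s 0) \<in> T" for i j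
      using transD[OF tr, of "c j" "s 0" "s i"] ss[of 0 i] cs[of 0 j] cs[of i j] that by blast
    \<comment> \<open>Transitivity yields \<open>i = k\<close> or \<open>i = 0\<close>;
      \<open>int\<close> excludes \<open>i = k\<close>.\<close>
    have C5: "i = 0 \<and> k \<noteq> 0"
      if "i \<le> m" "k \<le> m" "j \<in> {1..n}" "(s i, c j) \<in> R" "(c j, s k) \<in> T" for i j k
      using transD[OF tr, of "s i" "c j" "s k"] int[of i j] ss[of i k] sc[of i j] cs[of k j] that
      by metis
    have C6: "j \<le> k"
      if "i \<le> m" "j \<in> {1..n}" "k \<in> {1..n}" "(c j, s i) \<in> T" "(s i, c k) \<in> R" for i j k
      using transD[OF tr, of "c j" "s i" "c k"] cc[of j k] cs[of i j] sc[of i k] that by blast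
    show ?C
      by (intro conjI allI ballI impI; (elim conjE)?;
          (rule C1 C2 C3 C4 C5[THEN conjunct1] C5[THEN conjunct2] C6; assumption))
  next
    assume C: ?C
    \<comment> \<open>\<open>C1\<close> now holds both closure conditions on \<open>R\<close>, so
      the later numbers are one lower than in the other direction.\<close>
    note C1 = C[THEN conjunct1]
    note C2 = C[THEN conjunct2, THEN conjunct1]
    note C3 = C[THEN conjunct2, THEN conjunct2, THEN conjunct1]
    note C4 = C[THEN conjunct2, THEN conjunct2, THEN conjunct2, THEN conjunct1]
    note C5 = C[THEN conjunct2, THEN conjunct2, THEN conjunct2, THEN conjunct2]
    have "trans ?r"
    proof (rule transI)
      fix x y z
      assume xy: "(x, y) \<in> ?r" and yz: "(y, z) \<in> ?r"
      then have "(\<exists>i\<le>m. x = s i) \<or> (\<exists>i\<in>{1..n}. x = c i)"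
        "(\<exists>j\<le>m. y = s j) \<or> (\<exists>j\<in>{1..n}. y = c j)"
        "(\<exists>k\<le>m. z = s k) \<or> (\<exists>k\<in>{1..n}. z = c k)"
        using sub unfolding carrier by blast+
      \<comment> \<open>Eight cases, according to which of the three points lie on the star.\<close>
      then show "(x, z) \<in> ?r"
      proof (elim disjE exE bexE conjE)
        fix i j k assume "i \<le> m" "j \<le> m" "k \<le> m" "x = s i" "y = s j" "z = s k"
        then show ?thesis using xy yz ss[of i j] ss[of j k] ss[of i k] by blast
      next
        fix i j k assume "i \<le> m" "j \<le> m" "k \<in> {1..n}" "x = s i" "y = s j" "z = c k"
        then show ?thesis using xy yz ss[of i j] sc[of j k] sc[of i k] C1 by blast
      next
        fix i j k assume "i \<le> m" "j \<in> {1..n}" "k \<le> m" "x = s i" "y = c j" "z = s k"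
        then show ?thesis using xy yz ss[of i k] sc[of i j] cs[of k j] C4 by blast
      next
        fix i j k assume "i \<le> m" "j \<in> {1..n}" "k \<in> {1..n}" "x = s i" "y = c j" "z = c k"
        then show ?thesis using xy yz sc[of i j] cc[of j k] sc[of i k] C1 by blast
      next
        fix i j k assume "i \<in> {1..n}" "j \<le> m" "k \<le> m" "x = c i" "y = s j" "z = s k"
        then show ?thesis using xy yz ss[of j k] cs[of j i] cs[of k i] C3 by blast
      next
        fix i j k assume "i \<in> {1..n}" "j \<le> m" "k \<in> {1..n}" "x = c i" "y = s j" "z = c k"
        then show ?thesis using xy yz sc[of j k] cs[of j i] cc[of i k] C5 by blast
      next
        fix i j k assume "i \<in> {1..n}" "j \<in> {1..n}" "k \<le> m" "x = c i" "y = c j" "z = s k"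
        then show ?thesis using xy yz cc[of i j] cs[of k j] cs[of k i] C2 by blast
      next
        fix i j k assume "i \<in> {1..n}" "j \<in> {1..n}" "k \<in> {1..n}" "x = c i" "y = c j" "z = c k"
        then show ?thesis using xy yz cc[of i j] cc[of j k] cc[of i k] le_trans[of i j k] by blast
      qed
    qed
    moreover have "R \<inter> T\<inverse> = {}"
      \<comment> \<open>\<open>C4\<close> with \<open>k = i\<close> would demand both
        \<open>i = 0\<close> and \<open>i \<noteq> 0\<close>.\<close>
      unfolding inter using C4 by blast
    ultimately show "trans ?r \<and> R \<inter> T\<inverse> = {}" ..
  qed
  finally show ?thesis .
qed

section \<open>Inequalities between the thresholds\<close>

text \<open>Closure along the chain is built into the threshold form. Closure at \<open>s 0\<close>
  gives the comparisons with \<open>\<alpha> 0\<close> and \<open>\<beta> 0\<close>; paths through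
  the chain give \<open>\<alpha> k \<le> \<beta> i\<close>, except for \<open>i = 0\<close>,
  \<open>k \<noteq> 0\<close>.\<close>

lemma proper_merging_up_down_iff:
  assumes "\<And>i. i \<le> m \<Longrightarrow> \<alpha> i \<le> n" "\<And>i. i \<le> m \<Longrightarrow> \<beta> i \<le> n"
  shows "proper_merging (star_set m s) (star_le m s) (chain_set n c) (chain_le n c)
      (up_rel \<beta>) (down_rel \<alpha>) \<longleftrightarrow>
    \<alpha> 0 \<le> \<beta> 0 \<and> (\<forall>i\<in>{1..m}. \<alpha> 0 \<le> \<alpha> i \<and> \<beta> 0 \<le> \<beta> i) \<and> (\<forall>i\<in>{1..m}. \<forall>k\<in>{1..m}. \<alpha> k \<le> \<beta> i)"
  (is "_ \<longleftrightarrow> ?C")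
proof -
  have "up_rel \<beta> \<subseteq> star_set m s \<times> chain_set n c" "down_rel \<alpha> \<subseteq> chain_set n c \<times> star_set m s"
    by (auto simp: up_rel_def down_rel_def star_set_def chain_set_def)
  note iff = proper_merging_iff[OF this]
  have mem: "(s i, c j) \<in> up_rel \<beta> \<longleftrightarrow> \<beta> i < j" "(c j, s i) \<in> down_rel \<alpha> \<longleftrightarrow> j \<le> \<alpha> i"
    if "i \<le> m" "1 \<le> j" "j \<le> n" for i j
    using that by (simp_all add: mem_up_rel mem_down_rel)
  show ?thesis
  proof
    assume "proper_merging (star_set m s) (star_le m s) (chain_set n c) (chain_le n c)
      (up_rel \<beta>) (down_rel \<alpha>)"
    note H = this[unfolded iff]
    have "\<beta> 0 \<le> \<beta> i" if "i \<le> m" for i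
    proof (rule ccontr)
      assume "\<not> ?thesis"
      \<comment> \<open>If \<open>\<beta> i < \<beta> 0\<close>, the point
        \<open>c (\<beta> 0)\<close> lies above \<open>s i\<close> but not above
        \<open>s 0\<close>.\<close>
      then show False using H that assms(2)[of 0] mem(1)[of _ "\<beta> 0"]
        by (metis atLeastAtMost_iff le0 less_one linorder_not_less order_less_irrefl)
    qed
    moreover have "\<alpha> 0 \<le> \<alpha> i" if "i \<le> m" for i
    proof (rule ccontr)
      assume "\<not> ?thesis"
      \<comment> \<open>If \<open>\<alpha> i < \<alpha> 0\<close>, the point
        \<open>c (\<alpha> 0)\<close> lies below \<open>s 0\<close> but not below
        \<open>s i\<close>.\<close>
      then show False using H that assms(1)[of 0] mem(2)[of _ "\<alpha> 0"]
        by (metis atLeastAtMost_iff le0 less_one linorder_not_less order_refl)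
    qed
    moreover have "\<alpha> k \<le> \<beta> i" if "i \<le> m" "k \<le> m" "i \<noteq> 0 \<or> k = 0" for i k
    proof (rule ccontr)
      assume "\<not> ?thesis"
      \<comment> \<open>If \<open>\<beta> i < \<alpha> k\<close>, then \<open>c (\<alpha> k)\<close>
        lies between \<open>s i\<close> and \<open>s k\<close>, which is allowed only for
        \<open>i = 0\<close>, \<open>k \<noteq> 0\<close>.\<close>
      then have "(s i, c (\<alpha> k)) \<in> up_rel \<beta>" "(c (\<alpha> k), s k) \<in> down_rel \<alpha>" "\<alpha> k \<in> {1..n}"
        using that assms(1)[of k] by (auto simp: mem)
      then show False using H that by metis
    qed
    ultimately show ?C by simp
  next
    assume C: ?C
    then have "\<alpha> 0 \<le> \<alpha> i" "\<beta> 0 \<le> \<beta> i" if "i \<le> m" for i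
      using that by (cases "i = 0"; simp)+
    moreover have "\<alpha> k \<le> \<beta> i" if "i \<le> m" "k \<le> m" "i \<noteq> 0 \<or> k = 0" for i k
    proof -
      \<comment> \<open>The pairs with \<open>k = 0\<close> follow from
        \<open>\<alpha> 0 \<le> \<beta> 0 \<le> \<beta> i\<close>.\<close>
      have "\<alpha> 0 \<le> \<beta> 0" "i \<noteq> 0 \<Longrightarrow> \<beta> 0 \<le> \<beta> i" "i \<noteq> 0 \<Longrightarrow> k \<noteq> 0 \<Longrightarrow> \<alpha> k \<le> \<beta> i"
        using C that by auto
      then show ?thesis using that by (cases "k = 0"; cases "i = 0") auto
    qed
    ultimately have le: "\<And>i. i \<le> m \<Longrightarrow> \<alpha> 0 \<le> \<alpha> i" "\<And>i. i \<le> m \<Longrightarrow> \<beta> 0 \<le> \<beta> i"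
      "\<And>i k. i \<le> m \<Longrightarrow> k \<le> m \<Longrightarrow> i \<noteq> 0 \<or> k = 0 \<Longrightarrow> \<alpha> k \<le> \<beta> i" by blast+
    show "proper_merging (star_set m s) (star_le m s) (chain_set n c) (chain_le n c)
      (up_rel \<beta>) (down_rel \<alpha>)"
      unfolding iff
    proof (intro conjI allI ballI impI, goal_cases)
      case (1 i j)
      then show ?case using le(2)[of i] by (simp add: mem)
    next
      case (2 i j k)
      then show ?case by (simp add: mem)
    next
      case (3 i j k)
      then show ?case by (simp add: mem)
    next
      case (4 i j)
      then show ?case using le(1)[of i] by (simp add: mem)
    next
      case (5 i k j)
      then show ?case using le(3)[of i k] by (cases "i = 0") (auto simp: mem)
    next
      case (6 i k j)
      then show ?case using le(3)[of i k] by (cases "k = 0") (auto simp: mem)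
    next
      case (7 i j k)
      then show ?case using le(3)[of i i] by (cases "i = 0") (auto simp: mem)
    qed
  qed
qed

section \<open>The bijection with threshold tuples\<close>

lemma up_rel_eqD:
  assumes "up_rel \<beta> = up_rel \<beta>'" "i \<le> m" "\<beta> i \<le> n" "\<beta>' i \<le> n"
  shows "\<beta> i = \<beta>' i"
proof -
  have "\<beta> i < j \<longleftrightarrow> \<beta>' i < j" if "j \<in> {1..n}" for j
    using assms(1,2) that mem_up_rel by metis
  \<comment> \<open>Two different thresholds are separated at the larger one. Threshold 0 is not an
    index of the chain, hence the case split.\<close>
  from this[of "\<beta> i"] this[of "\<beta>' i"] show ?thesis
    using assms(3,4) by (cases "\<beta> i = 0"; cases "\<beta>' i = 0"; simp)
qed

lemma down_rel_eqD:
  assumes "down_rel \<alpha> = down_rel \<alpha>'" "i \<le> m" "\<alpha> i \<le> n" "\<alpha>' i \<le> n"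
  shows "\<alpha> i = \<alpha>' i"
proof -
  have "j \<le> \<alpha> i \<longleftrightarrow> j \<le> \<alpha>' i" if "j \<in> {1..n}" for j
    using assms(1,2) that mem_down_rel by metis
  from this[of "\<alpha> i"] this[of "\<alpha>' i"] show ?thesis
    using assms(3,4) by (cases "\<alpha> i = 0"; cases "\<alpha>' i = 0"; simp)
qed

lemma proper_merging_eq_up_down:
  assumes "proper_merging (star_set m s) (star_le m s) (chain_set n c) (chain_le n c) R T"
  obtains \<alpha> \<beta> where "\<And>i. \<alpha> i \<le> n" "\<And>i. \<beta> i \<le> n" "R = up_rel \<beta>" "T = down_rel \<alpha>"
proof -
  have R: "R \<subseteq> star_set m s \<times> chain_set n c" and T: "T \<subseteq> chain_set n c \<times> star_set m s"
    using assms by (auto simp: proper_merging_def merging_def)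
  note H = assms[unfolded proper_merging_iff[OF R T]]
  define \<alpha> where "\<alpha> i = card {j \<in> {1..n}. (c j, s i) \<in> T}" for i
  \<comment> \<open>The elements above \<open>s i\<close> form an up-closed set, so the initial
    segment to be measured is its complement.\<close>
  define \<beta> where "\<beta> i = card {j \<in> {1..n}. (s i, c j) \<notin> R}" for i
  have le_n: "card {j \<in> {1..n}. Q j} \<le> n" for Q
    using card_mono[of "{1..n}" "{j \<in> {1..n}. Q j}"] by fastforce
  have T_down: "(c k, s i) \<in> T" if "i \<le> m" "j \<in> {1..n}" "k \<in> {1..n}" "k \<le> j" "(c j, s i) \<in> T"
    for i j k
    using H that by blast
  have R_up: "(s i, c j) \<in> R" if "i \<le> m" "j \<in> {1..n}" "k \<in> {1..n}" "k \<le> j" "(s i, c k) \<in> R"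
    for i j k
    using H[THEN conjunct1] that by blast
  have T_iff: "(c j, s i) \<in> T \<longleftrightarrow> j \<le> \<alpha> i" if "i \<le> m" "j \<in> {1..n}" for i j
    unfolding \<alpha>_def by (rule down_closed_iff_le_card) (use T_down that in blast)+
  have T_eq: "T = down_rel \<alpha>"
  proof (intro equalityI subrelI)
    fix x y
    assume xy: "(x, y) \<in> T"
    with T obtain i j where "x = c j" "y = s i" "i \<le> m" "j \<in> {1..n}"
      by (fastforce simp: star_set_def chain_set_def)
    with xy show "(x, y) \<in> down_rel \<alpha>" by (simp only: mem_down_rel T_iff)
  next
    fix x y
    assume "(x, y) \<in> down_rel \<alpha>"
    then show "(x, y) \<in> T" unfolding down_rel_def using T_iff by blast
  qed
  have "(s i, c j) \<notin> R \<longleftrightarrow> j \<le> \<beta> i" if "i \<le> m" "j \<in> {1..n}" for i j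
    unfolding \<beta>_def by (rule down_closed_iff_le_card) (use R_up that in blast)+
  then have R_iff: "(s i, c j) \<in> R \<longleftrightarrow> \<beta> i < j" if "i \<le> m" "j \<in> {1..n}" for i j
    using that by (metis linorder_not_less)
  have R_eq: "R = up_rel \<beta>"
  proof (intro equalityI subrelI)
    fix x y
    assume xy: "(x, y) \<in> R"
    with R obtain i j where "x = s i" "y = c j" "i \<le> m" "j \<in> {1..n}"
      by (fastforce simp: star_set_def chain_set_def)
    with xy show "(x, y) \<in> up_rel \<beta>" by (simp only: mem_up_rel R_iff)
  next
    fix x y
    assume "(x, y) \<in> up_rel \<beta>"
    then show "(x, y) \<in> R" unfolding up_rel_def using R_iff by blast
  qed
  have "\<alpha> i \<le> n" "\<beta> i \<le> n" for i
    unfolding \<alpha>_def \<beta>_def by (rule le_n)+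
  from that[OF this R_eq T_eq] show thesis .
qed

text \<open>Needed because restricting to \<open>{1..m}\<close> and updating at 0 recovers a
  threshold function only on \<open>{0..m}\<close>.\<close>

lemma up_rel_cong: "(\<And>i. i \<le> m \<Longrightarrow> \<beta> i = \<beta>' i) \<Longrightarrow> up_rel \<beta> = up_rel \<beta>'"
  unfolding up_rel_def by (intro Collect_cong ex_cong1) auto

lemma down_rel_cong: "(\<And>i. i \<le> m \<Longrightarrow> \<alpha> i = \<alpha>' i) \<Longrightarrow> down_rel \<alpha> = down_rel \<alpha>'"
  unfolding down_rel_def by (intro Collect_cong ex_cong1) auto

text \<open>The update at 0 glues the threshold of \<open>s 0\<close> onto a function that is
  extensional on \<open>{1..m}\<close>.\<close>

lemma bij_betw_thresholds:
  assumes "m \<ge> 1"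
  shows "bij_betw (\<lambda>(p, q, a, b). (up_rel (b(0 := q)), down_rel (a(0 := p)))) (thresholds m n)
    (proper_mergings (star_set m s) (star_le m s) (chain_set n c) (chain_le n c))"
    (is "bij_betw ?f _ _")
proof (rule bij_betwI')
  fix x y
  assume xy: "x \<in> thresholds m n" "y \<in> thresholds m n"
  obtain p q a b p' q' a' b' where x: "x = (p, q, a, b)" and y: "y = (p', q', a', b')"
    by (metis prod_cases4)
  note mem = xy[unfolded x y mem_thresholds_iff[OF assms]]
  have le: "(b(0 := q)) i \<le> n" "(b'(0 := q')) i \<le> n" "(a(0 := p)) i \<le> n" "(a'(0 := p')) i \<le> n"
    if "i \<le> m" for i
    using mem that by (auto simp: PiE_iff)
  show "?f x = ?f y \<longleftrightarrow> x = y"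
  proof
    assume "?f x = ?f y"
    then have up: "up_rel (b(0 := q)) = up_rel (b'(0 := q'))"
      and down: "down_rel (a(0 := p)) = down_rel (a'(0 := p'))" by (simp_all add: x y)
    have eq: "(b(0 := q)) i = (b'(0 := q')) i" "(a(0 := p)) i = (a'(0 := p')) i" if "i \<le> m" for i
      using up_rel_eqD[OF up that] down_rel_eqD[OF down that] le[OF that] by blast+
    have "q = q'" "p = p'" using eq[of 0] by simp_all
    moreover have "b i = b' i" "a i = a' i" if "i \<in> {1..m}" for i
      using eq[of i] that by auto
    then have "b = b'" "a = a'"
      \<comment> \<open>Outside \<open>{1..m}\<close> both functions are
        \<open>undefined\<close>.\<close>
      using mem by (auto intro!: extensionalityI[where A = "{1..m}"] simp: PiE_iff)
    ultimately show "x = y" by (simp add: x y)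
  qed simp
next
  fix x
  assume x: "x \<in> thresholds m n"
  obtain p q a b where eq: "x = (p, q, a, b)" by (metis prod_cases4)
  note mem = x[unfolded eq mem_thresholds_iff[OF assms]]
  have "proper_merging (star_set m s) (star_le m s) (chain_set n c) (chain_le n c)
      (up_rel (b(0 := q))) (down_rel (a(0 := p)))"
    using mem by (subst proper_merging_up_down_iff) (auto simp: PiE_iff)
  then show "?f x \<in> proper_mergings (star_set m s) (star_le m s) (chain_set n c) (chain_le n c)"
    by (simp add: eq proper_mergings_def)
next
  fix y
  assume "y \<in> proper_mergings (star_set m s) (star_le m s) (chain_set n c) (chain_le n c)"
  then obtain R T where y: "y = (R, T)" and
    RT: "proper_merging (star_set m s) (star_le m s) (chain_set n c) (chain_le n c) R T"
    by (auto simp: proper_mergings_def)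
  from proper_merging_eq_up_down[OF RT] obtain \<alpha> \<beta> where
    le: "\<And>i. \<alpha> i \<le> n" "\<And>i. \<beta> i \<le> n" and eq: "R = up_rel \<beta>" "T = down_rel \<alpha>"
    by metis
  define x where "x = (\<alpha> 0, \<beta> 0, restrict \<alpha> {1..m}, restrict \<beta> {1..m})"
  have "x \<in> thresholds m n"
    using RT le unfolding x_def eq mem_thresholds_iff[OF assms]
    by (subst (asm) proper_merging_up_down_iff) auto
  moreover have "y = ?f x"
    by (auto simp: x_def y eq intro!: up_rel_cong down_rel_cong)
  ultimately show "\<exists>x\<in>thresholds m n. y = ?f x" by blast
qed

end

theorem theorem1p1:
  fixes m n :: nat and s c :: "nat \<Rightarrow> 'a"
  assumes "m \<ge> 1"
    and "inj_on s {0..m}"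
    and "inj_on c {1..n}"
    and "star_set m s \<inter> chain_set n c = {}"
  shows "card (proper_mergings (star_set m s) (star_le m s) (chain_set n c) (chain_le n c))
    = (\<Sum>k = 1..n + 1. k ^ m * (n + 2 - k) ^ (m + 1))"
proof -
  interpret star_chain m n s c using assms(2-4) by unfold_locales
  show ?thesis
    using bij_betw_same_card[OF bij_betw_thresholds[OF assms(1)]] card_thresholds[OF assms(1)]
    by simp
qed

end
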